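(* As $p$ ranges over the primes, $$\sharp\,\mathcal M_2^{\neq\square}(p)=\frac58\,p^4+O(p^3),$$ that is, there is an absolute constant $K$ such that $\left|\sharp\,\mathcal M_2^{\neq\square}(p)-\frac58p^4\right|\le Kp^3$ for every prime $p$.
   Context: $\mathcal M_2^*(p)=\mathrm{GL}(2,\mathbb F_p)$ is the set of invertible $2\times 2$ matrices over the field $\mathbb F_p$ of $p$ elements, and $$\mathcal M_2^{\neq\square}(p)=\{A\in\mathcal M_2^*(p): A\neq B^2\text{ for all }B\in\mathcal M_2^*(p)\}.$$ $\sharp S$ denotes the cardinality of a finite set $S$. *)

theory Defs
  imports
    "HOL-Number_Theory.Residues"
    "HOL-Analysis.Finite_Cartesian_Product"
begin

text \<open>The library's matrix product and inverse presuppose a ring structure on the entry type.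
  Here \<open>p\<close> is bound inside the statement, so the entry ring is a record \<open>R\<close> and
  the entries are required to lie in its carrier. The matrix \<open>A\<close> has the entry
  \<open>A $ i $ j\<close> in row \<open>i\<close> and column \<open>j\<close>.\<close>

definition matrix_monoid :: "('a, 'm) ring_scheme \<Rightarrow> ('a ^ 'n ^ 'n) monoid" where
  "matrix_monoid R =
    \<lparr>carrier = {A. \<forall>i j. A $ i $ j \<in> carrier R},
     monoid.mult = (\<lambda>A B. \<chi> i j. finsum R (\<lambda>k. A $ i $ k \<otimes>\<^bsub>R\<^esub> B $ k $ j) UNIV),
     one = (\<chi> i j. if i = j then \<one>\<^bsub>R\<^esub> else \<zero>\<^bsub>R\<^esub>)\<rparr>"

text \<open>\<open>residue_ring (int p)\<close> is the field with \<open>p\<close> elements when \<open>p\<close> is prime.\<close>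

definition GL2 :: "nat \<Rightarrow> (int ^ 2 ^ 2) set" where
  "GL2 p = Units (matrix_monoid (residue_ring (int p)))"

definition GL2_nonsquare :: "nat \<Rightarrow> (int ^ 2 ^ 2) set" where
  "GL2_nonsquare p =
    {A \<in> GL2 p. \<forall>B \<in> GL2 p. A \<noteq> B \<otimes>\<^bsub>matrix_monoid (residue_ring (int p))\<^esub> B}"

end

theory Submission
  imports Defs "HOL-Analysis.Determinants"
begin

text \<open>Whether an invertible matrix \<open>A\<close> over the field with \<open>p\<close> elements is a square is decided,
  up to few exceptions, by its trace and determinant. If \<open>A = B\<^sup>2\<close> where \<open>B\<close> has trace \<open>t\<close> and
  determinant \<open>d\<close>, then \<open>A\<close> has trace \<open>t\<^sup>2 - 2 d\<close> and determinant \<open>d\<^sup>2\<close>. Conversely, when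
  \<open>t \<noteq> 0\<close>, every matrix with that trace and determinant is the square of \<open>(A + d) / t\<close>, by the
  Cayley--Hamilton theorem (lemma \<open>fiber_squares\<close>). Matrices \<open>B\<close> with \<open>t = 0\<close> only contribute scalar
  squares, at most \<open>p\<close> of them (\<open>traceless_square_scalar\<close>).

  Every trace and determinant belong to \<open>p\<^sup>2 + O(p)\<close> matrices (\<open>card_fiber_bounds\<close>), so it remains
  to count the values of \<open>(t, d) \<mapsto> (t\<^sup>2 - 2 d, d\<^sup>2)\<close> on pairs of nonzero \<open>t\<close> and \<open>d\<close>, for odd \<open>p\<close>.
  The sign of \<open>t\<close> is always lost. The sign of \<open>d\<close> is lost as well precisely when the discriminant
  \<open>t\<^sup>2 - 4 d\<close> is a nonzero square \<open>s\<^sup>2\<close>, because \<open>(t, d)\<close> and \<open>(s, - d)\<close> then have the same value.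
  This happens for half of the pairs asymptotically, so half of the pairs lie in fibers of size 4 and
  half in fibers of size 2. The number of values is exactly \<open>(p - 1) (3 p - 1) / 8\<close>
  (\<open>card_square_trace_det\<close>). Multiplying by \<open>p\<^sup>2\<close> leaves \<open>3 p\<^sup>4 / 8\<close> squares among \<open>p\<^sup>4\<close>
  matrices, with errors of order \<open>p\<^sup>3\<close>; the singular matrices also number only \<open>O(p\<^sup>3)\<close>.\<close>

section \<open>Matrices over a prime field\<close>

text \<open>This turns computing in the residue field into checking a polynomial identity over the
  integers: a congruence follows from two others once the coefficients that express it as a
  combination of them are supplied.\<close>
lemma cong_lincomb:
  fixes x x' y y' z z' a b m :: int
  assumes "[x = x'] (mod m)" "[y = y'] (mod m)"
    and "z - z' = a * (x - x') + b * (y - y')"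
  shows "[z = z'] (mod m)"
  using assms by (simp add: cong_iff_dvd_diff)

context residues_prime
begin

abbreviation F :: "int set" where "F \<equiv> {0..<int p}"
abbreviation M where "M \<equiv> carrier (matrix_monoid R)"

lemma p_gt_1: "1 < p"
  using p_prime prime_gt_1_nat by blast

lemma p_pos [simp]: "0 < p"
  using p_gt_1 by simp

lemma mod_in_F: "x mod int p \<in> F"
  by simp

lemma prime_int_p: "prime (int p)"
  using p_prime by simp

lemma cong_in_F:
  assumes "[x = y] (mod int p)" "x \<in> F" "y \<in> F"
  shows "x = y"
  using assms by (simp add: cong_def)

lemma obtain_inverse:
  assumes "\<not> int p dvd x"
  obtains u where "[u * x = 1] (mod int p)"
  using cong_solve_coprime_int[of x "int p"] assms p_coprime_right_int[of x]
  by (metis mult.commute)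

text \<open>The product in the matrix monoid is the product of integer matrices followed by reduction of
  the entries. Up to congruence, the trace and the determinant of integer matrices, with the
  multiplicativity of the latter, thus serve for matrices over the residue field.\<close>
definition reduce :: "int^'n^'n \<Rightarrow> int^'n^'n"
  where "reduce A = (\<chi> i j. A $ i $ j mod int p)"

lemma M_eq: "M = {A. \<forall>i j. A $ i $ j \<in> F}"
  by (auto simp: matrix_monoid_def res_carrier_eq)

lemma M_nth: "A \<in> M \<Longrightarrow> A $ i $ j \<in> F"
  by (simp add: M_eq)

lemma reduce_in_M [simp]: "reduce A \<in> M"
  by (simp add: M_eq reduce_def)

lemma matrix_mult_eq: "A \<otimes>\<^bsub>matrix_monoid R\<^esub> B = reduce (A ** B)"
  by (simp add: matrix_monoid_def reduce_def matrix_matrix_mult_def res_mult_eq sum_cong)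

lemma matrix_one_eq: "\<one>\<^bsub>matrix_monoid R\<^esub> = mat 1"
  by (simp add: matrix_monoid_def mat_def res_one_eq res_zero_eq vec_eq_iff)

lemma reduce_eq_iff:
  assumes "A \<in> M"
  shows "A = reduce B \<longleftrightarrow> (\<forall>i j. [A $ i $ j = B $ i $ j] (mod int p))"
  using M_nth[OF assms] by (auto simp: reduce_def vec_eq_iff cong_def)

lemma reduce_mult_reduce:
  "reduce (A ** reduce B) = reduce (A ** B)" "reduce (reduce A ** B) = reduce (A ** B)"
  by (auto simp: reduce_def matrix_matrix_mult_def vec_eq_iff simp flip: cong_def
      intro!: cong_sum cong_mult)

lemma det_reduce: "[det (reduce A) = det A] (mod int p)" for A :: "int^2^2"
  unfolding det_2 reduce_def by (intro cong_diff cong_mult) simp_all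

lemma trace_reduce: "[trace (reduce A) = trace A] (mod int p)" for A :: "int^2^2"
  by (auto simp: trace_def sum_2 reduce_def cong_def mod_simps)

lemma GL2_eq: "GL2 p = {A \<in> M. \<not> int p dvd det A}"
proof -
  have "A \<in> Units (matrix_monoid R) \<longleftrightarrow> A \<in> M \<and> \<not> int p dvd det A" for A :: "int^2^2"
  proof
    assume "A \<in> Units (matrix_monoid R)"
    then obtain B where A: "A \<in> M" and B: "reduce (A ** B) = mat 1"
      by (auto simp: Units_def matrix_mult_eq matrix_one_eq)
    have "[det A * det B = 1] (mod int p)"
      using det_reduce[of "A ** B"] by (simp add: B det_mul cong_sym)
    then have "\<not> int p dvd det A"
      using prime_int_p by (metis cong_dvd_iff dvd_mult2 not_prime_unit)
    with A show "A \<in> M \<and> \<not> int p dvd det A" by simp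
  next
    assume "A \<in> M \<and> \<not> int p dvd det A"
    then have A: "A \<in> M" and "\<not> int p dvd det A" by auto
    then obtain u where u: "[u * det A = 1] (mod int p)"
      using obtain_inverse by blast
    \<comment> \<open>The adjugate, scaled by an inverse \<open>u\<close> of the determinant.\<close>
    define C :: "int^2^2" where "C = (\<chi> i j. u *
       (if i = 1 then (if j = 1 then A$2$2 else - A$1$2) else (if j = 1 then - A$2$1 else A$1$1)))"
    define B where "B = reduce C"
    have AC: "A ** C = (\<chi> i j. if i = j then u * det A else 0)"
      by (simp add: vec_eq_iff forall_2 matrix_matrix_mult_def sum_2 C_def det_2 algebra_simps)
    have CA: "C ** A = (\<chi> i j. if i = j then u * det A else 0)"
      by (simp add: vec_eq_iff forall_2 matrix_matrix_mult_def sum_2 C_def det_2 algebra_simps)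
    have "reduce (A ** B) = reduce (A ** C)"
      by (simp add: B_def reduce_mult_reduce)
    also have "\<dots> = mat 1"
      using u p_gt_1 by (auto simp: AC reduce_def mat_def vec_eq_iff cong_def)
    finally have AB: "reduce (A ** B) = mat 1" .
    have "reduce (B ** A) = reduce (C ** A)"
      by (simp add: B_def reduce_mult_reduce)
    also have "\<dots> = mat 1"
      using u p_gt_1 by (auto simp: CA reduce_def mat_def vec_eq_iff cong_def)
    finally have BA: "reduce (B ** A) = mat 1" .
    have "B \<in> M" by (simp add: B_def)
    with A AB BA show "A \<in> Units (matrix_monoid R)"
      by (auto simp: Units_def matrix_mult_eq matrix_one_eq)
  qed
  then show ?thesis
    by (auto simp: GL2_def R_m_def)
qed

lemma card_M: "card (M :: (int^2^2) set) = p ^ 4" "finite (M :: (int^2^2) set)"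
proof -
  define mk where "mk = (\<lambda>(a, b, c, d). (\<chi> i j. if i = 1 then (if j = 1 then a else b)
    else (if j = 1 then c else d)) :: int^2^2)"
  have "bij_betw mk (F \<times> F \<times> F \<times> F) M"
    by (rule bij_betwI[where g = "\<lambda>A. (A$1$1, A$1$2, A$2$1, A$2$2)"])
       (auto simp: mk_def M_eq vec_eq_iff forall_2)
  from bij_betw_same_card[OF this] bij_betw_finite[OF this]
  show "card (M :: (int^2^2) set) = p ^ 4" "finite (M :: (int^2^2) set)"
    by (simp_all add: card_cartesian_product eval_nat_numeral)
qed

section \<open>Matrices of given trace and determinant\<close>

definition fiber :: "int \<Rightarrow> int \<Rightarrow> (int^2^2) set"
  where "fiber T D = {A \<in> M. [trace A = T] (mod int p) \<and> [det A = D] (mod int p)}"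

lemma card_linear_congruence:
  assumes "\<not> int p dvd b"
  shows "card {c \<in> F. [b * c = n] (mod int p)} = 1"
proof -
  obtain u where u: "[u * b = 1] (mod int p)"
    using obtain_inverse[OF assms] .
  have "[b * c = n] (mod int p) \<longleftrightarrow> c = u * n mod int p" if "c \<in> F" for c
  proof
    assume h: "[b * c = n] (mod int p)"
    have "[c = u * n] (mod int p)"
      by (rule cong_lincomb[OF u h, of _ _ "- c" u]) (simp add: algebra_simps power2_eq_square)
    then show "c = u * n mod int p" using that by (simp add: cong_def)
  next
    assume c: "c = u * n mod int p"
    then have h: "[c = u * n] (mod int p)" by simp
    show "[b * c = n] (mod int p)"
      by (rule cong_lincomb[OF u h, of _ _ n b]) (simp add: algebra_simps power2_eq_square)
  qed
  then have "{c \<in> F. [b * c = n] (mod int p)} = {u * n mod int p}"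
    using p_gt_1 by auto
  then show ?thesis by simp
qed

text \<open>Two solutions \<open>a\<close> and \<open>x\<close> satisfy \<open>(x - a) * (T - a - x) = 0\<close> in the field: the solutions
  are the roots of the characteristic polynomial with trace \<open>T\<close> and determinant \<open>D\<close>, and they
  sum to \<open>T\<close>.\<close>
lemma card_char_poly_roots: "card {a \<in> F. [a * (T - a) = D] (mod int p)} \<le> 2"
proof (cases "{a \<in> F. [a * (T - a) = D] (mod int p)} = {}")
  case False
  then obtain a where a: "a \<in> F" "[a * (T - a) = D] (mod int p)" by auto
  have "x \<in> {a, (T - a) mod int p}" if x: "x \<in> F" "[x * (T - x) = D] (mod int p)" for x
  proof -
    have "[(x - a) * (T - a - x) = 0] (mod int p)"
      by (rule cong_lincomb[OF a(2) x(2), of _ _ "-1" 1]) (simp add: algebra_simps power2_eq_square)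
    then have "int p dvd (x - a) * (T - a - x)"
      by (simp add: cong_0_iff)
    then consider "int p dvd x - a" | "int p dvd T - a - x"
      using prime_int_p prime_dvd_mult_iff by blast
    then show ?thesis
    proof cases
      case 1
      then have "x = a" using a x cong_in_F by (simp add: cong_iff_dvd_diff)
      then show ?thesis by simp
    next
      case 2
      then have "[T - a = x] (mod int p)" by (simp add: cong_iff_dvd_diff)
      then show ?thesis using x by (simp add: cong_def)
    qed
  qed
  then have "{a \<in> F. [a * (T - a) = D] (mod int p)} \<subseteq> {a, (T - a) mod int p}" by blast
  then have "card {a \<in> F. [a * (T - a) = D] (mod int p)} \<le> card {a, (T - a) mod int p}"
    by (intro card_mono) auto
  also have "\<dots> \<le> 2" by (simp add: card_insert_if)
  finally show ?thesis .
qed (simp only: card.empty)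

text \<open>The lower right entry is determined by the trace. For a first row \<open>(a, b)\<close> with \<open>b\<close>
  nonzero, the determinant then fixes the remaining entry; for \<open>b = 0\<close> that entry is arbitrary
  or impossible, according to whether \<open>a\<close> is a root of the characteristic polynomial.\<close>
lemma card_fiber:
  "card (fiber T D) = p * (p - 1) + p * card {a \<in> F. [a * (T - a) = D] (mod int p)}"
proof -
  define C where "C a b = {c \<in> F. [b * c = a * (T - a) - D] (mod int p)}" for a b
  define mk where "mk = (\<lambda>(a, b, c). (\<chi> i j. if i = 1 then (if j = 1 then a else b)
    else (if j = 1 then c else (T - a) mod int p)) :: int^2^2)"
  have "bij_betw mk (SIGMA a:F. SIGMA b:F. C a b) (fiber T D)"
  proof (rule bij_betwI[where g = "\<lambda>A. (A$1$1, A$1$2, A$2$1)"])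
    show "mk \<in> (SIGMA a:F. SIGMA b:F. C a b) \<rightarrow> fiber T D"
    proof (clarsimp simp: C_def simp del: atLeastLessThan_iff)
      fix a b c assume a: "a \<in> F" "b \<in> F" "c \<in> F" "[b * c = a * (T - a) - D] (mod int p)"
      define d where "d = (T - a) mod int p"
      have d: "[d = T - a] (mod int p)" "d \<in> F" by (simp_all add: d_def)
      have "[a + d = T] (mod int p)"
        by (rule cong_lincomb[OF d(1) a(4), of _ _ 1 0]) (simp add: algebra_simps power2_eq_square)
      moreover have "[a * d - b * c = D] (mod int p)"
        by (rule cong_lincomb[OF d(1) a(4), of _ _ a "-1"]) (simp add: algebra_simps power2_eq_square)
      ultimately show "mk (a, b, c) \<in> fiber T D"
        using a d by (simp add: mk_def fiber_def M_eq forall_2 trace_def sum_2 det_2 d_def)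
    qed
    show "(\<lambda>A. (A$1$1, A$1$2, A$2$1)) \<in> fiber T D \<rightarrow> (SIGMA a:F. SIGMA b:F. C a b)"
    proof
      fix A assume "A \<in> fiber T D"
      then have A: "\<And>i j. A$i$j \<in> F" and t: "[A$1$1 + A$2$2 = T] (mod int p)"
        and d: "[A$1$1 * A$2$2 - A$1$2 * A$2$1 = D] (mod int p)"
        by (simp_all add: fiber_def M_eq trace_def sum_2 det_2)
      have "[A$1$2 * A$2$1 = A$1$1 * (T - A$1$1) - D] (mod int p)"
        by (rule cong_lincomb[OF t d, of _ _ "A$1$1" "-1"]) (simp add: algebra_simps power2_eq_square)
      with A show "(A$1$1, A$1$2, A$2$1) \<in> (SIGMA a:F. SIGMA b:F. C a b)"
        by (simp add: C_def)
    qed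
    show "(mk x $ 1 $ 1, mk x $ 1 $ 2, mk x $ 2 $ 1) = x" for x
      by (cases x) (simp add: mk_def)
    show "mk (A$1$1, A$1$2, A$2$1) = A" if "A \<in> fiber T D" for A
    proof -
      have A: "A$2$2 \<in> F" and t: "[A$1$1 + A$2$2 = T] (mod int p)"
        using that by (simp_all add: fiber_def M_eq trace_def sum_2)
      have "[T - A$1$1 = A$2$2] (mod int p)"
        by (rule cong_lincomb[OF t t, of _ _ "-1" 0]) (simp add: algebra_simps power2_eq_square)
      with A show ?thesis
        by (simp add: mk_def vec_eq_iff forall_2 cong_def)
    qed
  qed
  then have "card (fiber T D) = card (SIGMA a:F. SIGMA b:F. C a b)"
    by (metis bij_betw_same_card)
  also have "\<dots> = (\<Sum>a\<in>F. \<Sum>b\<in>F. card (C a b))"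
  proof -
    have "finite (C a b)" for a b
      unfolding C_def by (rule finite_subset[of _ F]) auto
    then show ?thesis by (simp add: finite_SigmaI)
  qed
  also have "\<dots> = (\<Sum>a\<in>F. (p - 1) + (if [a * (T - a) = D] (mod int p) then p else 0))"
  proof (rule sum.cong[OF refl])
    fix a
    have "card (C a b) = 1" if "b \<in> F - {0}" for b
      using that unfolding C_def by (intro card_linear_congruence) (auto simp: zdvd_not_zless)
    then have "(\<Sum>b\<in>F. card (C a b)) = card (C a 0) + card (F - {0})"
      using p_gt_1 by (subst sum.remove[of F 0]) auto
    moreover have "C a 0 = (if [a * (T - a) = D] (mod int p) then F else {})"
      by (auto simp: C_def cong_iff_dvd_diff dvd_diff_commute)
    ultimately show "(\<Sum>b\<in>F. card (C a b)) =
        (p - 1) + (if [a * (T - a) = D] (mod int p) then p else 0)"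
      using p_gt_1 by simp
  qed
  also have "\<dots> = p * (p - 1) + p * card {a \<in> F. [a * (T - a) = D] (mod int p)}"
    by (simp only: sum.distrib) (simp add: sum.If_cases Int_def)
  finally show ?thesis .
qed

lemma card_fiber_bounds:
  "\<bar>real (card (fiber T D)) - real p ^ 2\<bar> \<le> real p"
proof -
  define r where "r = card {a \<in> F. [a * (T - a) = D] (mod int p)}"
  have "r \<in> {0, 1, 2}" using card_char_poly_roots[of T D] unfolding r_def[symmetric] by auto
  moreover have "real (card (fiber T D)) = real p * (real p - 1) + real p * real r"
    using p_gt_1 by (simp add: card_fiber r_def of_nat_diff)
  ultimately show ?thesis by (auto simp: power2_eq_square algebra_simps)
qed

section \<open>Squares in terms of trace and determinant\<close>

lemma trace_square: "trace (B ** B) = trace B ^ 2 - 2 * det B" for B :: "int^2^2"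
  by (simp add: trace_def sum_2 det_2 matrix_matrix_mult_def power2_eq_square algebra_simps)

text \<open>If \<open>B\<close> has trace \<open>t\<close> and determinant \<open>d\<close>, then \<open>B\<^sup>2 = t B - d\<close> by the Cayley--Hamilton theorem,
  so the only candidate for a square root of \<open>A\<close> is \<open>(A + d) / t\<close>. The characteristic equation of
  \<open>A\<close> itself shows that this candidate works.\<close>
lemma fiber_squares:
  assumes A: "A \<in> fiber (t^2 - 2 * d) (d^2)" and d: "\<not> int p dvd d" and t: "\<not> int p dvd t"
  shows "\<exists>B \<in> GL2 p. A = reduce (B ** B)"
proof -
  obtain u where u: "[u * t = 1] (mod int p)"
    using obtain_inverse[OF t] .
  \<comment> \<open>\<open>B = (A + d) / t\<close>\<close>
  define B where "B = (\<chi> i j. u * (A$i$j + (if i = j then d else 0)))"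
  have "A \<in> M" and T: "[A$1$1 + A$2$2 = t^2 - 2 * d] (mod int p)"
    and D: "[A$1$1 * A$2$2 - A$1$2 * A$2$1 = d^2] (mod int p)"
    using A by (simp_all add: fiber_def trace_def sum_2 det_2)
  have *: "[u^2 * (A$1$1 + A$2$2 + 2 * d) = 1] (mod int p)"
    by (rule cong_lincomb[OF T u, of _ _ "u^2" "u * t + 1"]) (simp add: algebra_simps power2_eq_square)
  have "[A$1$1 = (B ** B)$1$1] (mod int p)"
    by (rule cong_lincomb[OF * D, of _ _ "- A$1$1" "u^2"])
       (simp add: B_def matrix_matrix_mult_def sum_2 algebra_simps power2_eq_square)
  moreover have "[A$2$2 = (B ** B)$2$2] (mod int p)"
    by (rule cong_lincomb[OF * D, of _ _ "- A$2$2" "u^2"])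
       (simp add: B_def matrix_matrix_mult_def sum_2 algebra_simps power2_eq_square)
  moreover have "[A$1$2 = (B ** B)$1$2] (mod int p)"
    by (rule cong_lincomb[OF * D, of _ _ "- A$1$2" 0])
       (simp add: B_def matrix_matrix_mult_def sum_2 algebra_simps power2_eq_square)
  moreover have "[A$2$1 = (B ** B)$2$1] (mod int p)"
    by (rule cong_lincomb[OF * D, of _ _ "- A$2$1" 0])
       (simp add: B_def matrix_matrix_mult_def sum_2 algebra_simps power2_eq_square)
  ultimately have AB: "A = reduce (B ** B)"
    by (simp add: reduce_eq_iff[OF \<open>A \<in> M\<close>] forall_2)
  then have "[det A = det B * det B] (mod int p)"
    by (simp add: det_reduce flip: det_mul)
  moreover have "[det A = d^2] (mod int p)" using A by (simp add: fiber_def)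
  ultimately have "[d^2 = det B * det B] (mod int p)"
    by (metis cong_sym cong_trans)
  then have "\<not> int p dvd det B"
    using d prime_int_p by (metis cong_dvd_iff dvd_mult2 prime_dvd_power)
  moreover have "[det (reduce B) = det B] (mod int p)" by (rule det_reduce)
  ultimately have "reduce B \<in> GL2 p"
    by (simp add: GL2_eq cong_dvd_iff)
  moreover have "A = reduce (reduce B ** reduce B)"
    by (simp add: AB reduce_mult_reduce)
  ultimately show ?thesis by blast
qed

lemma square_in_fiber:
  assumes "[trace B = t] (mod int p)" "[det B = d] (mod int p)"
  shows "reduce (B ** B) \<in> fiber (t^2 - 2 * d) (d^2)"
proof -
  have "[trace B ^ 2 - 2 * det B = t^2 - 2 * d] (mod int p)"
    using assms by (intro cong_diff cong_pow cong_mult) auto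
  moreover have "[det B ^ 2 = d^2] (mod int p)"
    using assms by (intro cong_pow)
  ultimately show ?thesis
    using trace_reduce[of "B ** B"] det_reduce[of "B ** B"]
    by (auto simp: fiber_def trace_square det_mul power2_eq_square intro: cong_trans)
qed

text \<open>For \<open>t = 0\<close> the Cayley--Hamilton theorem gives \<open>B\<^sup>2 = - d\<close>. These squares escape the
  criterion above, but there are too few scalar matrices for them to matter.\<close>
lemma traceless_square_scalar:
  fixes B :: "int^2^2"
  assumes t: "[trace B = 0] (mod int p)"
  shows "reduce (B ** B) \<in> (\<lambda>x. mat x) ` F"
proof -
  define x where "x = - det B mod int p"
  have x: "[x = - det B] (mod int p)" and "x \<in> F" by (simp_all add: x_def)
  have t: "[B$1$1 + B$2$2 = 0] (mod int p)"
    using t by (simp add: trace_def sum_2)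
  have x: "[x = B$1$2 * B$2$1 - B$1$1 * B$2$2] (mod int p)"
    using x by (simp add: det_2)
  have "[x = (B ** B)$1$1] (mod int p)"
    by (rule cong_lincomb[OF t x, of _ _ "- B$1$1" 1])
       (simp add: matrix_matrix_mult_def sum_2 algebra_simps power2_eq_square)
  moreover have "[x = (B ** B)$2$2] (mod int p)"
    by (rule cong_lincomb[OF t x, of _ _ "- B$2$2" 1])
       (simp add: matrix_matrix_mult_def sum_2 algebra_simps power2_eq_square)
  moreover have "[0 = (B ** B)$1$2] (mod int p)"
    by (rule cong_lincomb[OF t x, of _ _ "- B$1$2" 0])
       (simp add: matrix_matrix_mult_def sum_2 algebra_simps power2_eq_square)
  moreover have "[0 = (B ** B)$2$1] (mod int p)"
    by (rule cong_lincomb[OF t x, of _ _ "- B$2$1" 0])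
       (simp add: matrix_matrix_mult_def sum_2 algebra_simps power2_eq_square)
  moreover have "mat x \<in> M"
    using \<open>x \<in> F\<close> by (simp add: M_eq mat_def)
  ultimately have "mat x = reduce (B ** B)"
    by (simp add: reduce_eq_iff[OF \<open>mat x \<in> M\<close>] forall_2) (simp add: mat_def)
  then show ?thesis using \<open>x \<in> F\<close> by (metis imageI)
qed

end

section \<open>Counting the traces and determinants of squares\<close>

lemma card_constant_fibers:
  assumes "finite X" "\<And>x. x \<in> X \<Longrightarrow> card {y \<in> X. f y = f x} = k"
  shows "card X = k * card (f ` X)"
proof -
  have "card X = (\<Sum>z \<in> f ` X. card {y \<in> X. f y = z})"
    using sum.image_gen[OF assms(1), of "\<lambda>_. 1 :: nat" f] by simp
  also have "\<dots> = (\<Sum>z \<in> f ` X. k)"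
    using assms(2) by (intro sum.cong) auto
  finally show ?thesis by simp
qed

locale residues_odd_prime = residues_prime +
  assumes odd_p: "odd p"
begin

abbreviation F' :: "int set" where "F' \<equiv> {1..<int p}"

lemma card_F': "card F' = p - 1"
  by (simp add: nat_diff_distrib')

lemma F'_not_dvd: "x \<in> F' \<Longrightarrow> \<not> int p dvd x"
  by (auto simp: zdvd_not_zless)

lemma mod_in_F': "\<not> int p dvd x \<Longrightarrow> x mod int p \<in> F'"
  by (simp add: dvd_eq_mod_eq_0 order_neq_le_trans int_one_le_iff_zero_less)

lemma cong_in_F':
  assumes "[x = y] (mod int p)" "x \<in> F'" "y \<in> F'"
  shows "x = y"
  using assms by (simp add: cong_def)

lemma neg_in_F': "x \<in> F' \<Longrightarrow> int p - x \<in> F'"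
  by auto

lemma neg_neq: "int p - x \<noteq> x"
  using odd_p by presburger

lemma square_cong_iff:
  assumes "x \<in> F'" "y \<in> F'"
  shows "[y^2 = x^2] (mod int p) \<longleftrightarrow> y = x \<or> y = int p - x"
proof
  assume "[y^2 = x^2] (mod int p)"
  then have "int p dvd (y - x) * (y - (int p - x) + int p)"
    by (simp add: cong_iff_dvd_diff power2_eq_square algebra_simps)
  then have "int p dvd y - x \<or> int p dvd y - (int p - x)"
    using prime_int_p prime_dvd_mult_iff by (metis dvd_add_left_iff dvd_refl)
  then have "[y = x] (mod int p) \<or> [y = int p - x] (mod int p)"
    by (simp add: cong_iff_dvd_diff)
  then show "y = x \<or> y = int p - x"
    using cong_in_F' assms neg_in_F' by blast
next
  assume "y = x \<or> y = int p - x"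
  then show "[y^2 = x^2] (mod int p)"
  proof
    assume y: "y = int p - x"
    have "y^2 - x^2 = int p * (int p - 2 * x)"
      unfolding y by (simp add: power2_eq_square algebra_simps)
    then show ?thesis by (simp add: cong_iff_dvd_diff)
  qed auto
qed

text \<open>If \<open>B\<close> has trace \<open>t\<close> and determinant \<open>d\<close>, these are the trace and determinant of \<open>B\<^sup>2\<close>.\<close>
definition square_trace_det :: "int \<times> int \<Rightarrow> int \<times> int"
  where "square_trace_det = (\<lambda>(t, d). ((t^2 - 2 * d) mod int p, d^2 mod int p))"

text \<open>Since \<open>p\<close> is odd, a nonzero square as discriminant means that \<open>x\<^sup>2 - t x + d\<close> splits into
  distinct linear factors. A matrix with trace \<open>t\<close> and determinant \<open>d\<close> then has two distinct
  eigenvalues in the field.\<close>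
definition split_pairs :: "(int \<times> int) set"
  where "split_pairs = {(t, d). t \<in> F' \<and> d \<in> F' \<and> (\<exists>s\<in>F'. [s^2 = t^2 - 4 * d] (mod int p))}"

text \<open>Equal determinants of the squares mean \<open>d' = d\<close> or \<open>d' = - d\<close>. In the second case the
  traces of the squares agree exactly when \<open>t'\<close> is a square root of the discriminant
  \<open>t\<^sup>2 - 4 d\<close>; this is why splitting decides the size of the fibers.\<close>
lemma square_trace_det_eq_iff:
  assumes "t \<in> F'" "d \<in> F'" "t' \<in> F'" "d' \<in> F'"
  shows "square_trace_det (t', d') = square_trace_det (t, d) \<longleftrightarrow>
    d' = d \<and> (t' = t \<or> t' = int p - t) \<or> d' = int p - d \<and> [t'^2 = t^2 - 4 * d] (mod int p)"
proof -
  have "[t'^2 - 2 * d = t^2 - 2 * d] (mod int p) \<longleftrightarrow> [t'^2 = t^2] (mod int p)"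
    by (simp add: cong_iff_dvd_diff)
  moreover have "[t'^2 - 2 * (int p - d) = t^2 - 2 * d] (mod int p) \<longleftrightarrow>
      [t'^2 = t^2 - 4 * d] (mod int p)" (is "?L \<longleftrightarrow> ?R")
  proof -
    have "?L \<longleftrightarrow> int p dvd (t'^2 - (t^2 - 4 * d)) + int p * (-2)"
      by (simp add: cong_iff_dvd_diff algebra_simps)
    also have "\<dots> \<longleftrightarrow> ?R"
      unfolding cong_iff_dvd_diff by (rule dvd_add_left_iff) simp
    finally show ?thesis .
  qed
  moreover have "square_trace_det (t', d') = square_trace_det (t, d) \<longleftrightarrow>
      [t'^2 - 2 * d' = t^2 - 2 * d] (mod int p) \<and> (d' = d \<or> d' = int p - d)"
    using square_cong_iff[of d d'] assms by (simp add: square_trace_det_def cong_def)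
  ultimately show ?thesis
    using square_cong_iff[of t t'] assms by auto
qed

text \<open>If \<open>B\<close> has the eigenvalues \<open>x\<close> and \<open>y\<close>, the four pairs are the sum and the product of \<open>\<plusminus>x\<close> and
  \<open>\<plusminus>y\<close> for the four choices of signs, all with the same squares \<open>x\<^sup>2\<close> and \<open>y\<^sup>2\<close>. If \<open>s\<close> is a square root of the discriminant of \<open>(t, d)\<close>, then
  \<open>t\<close> is one of the discriminant of \<open>(s, - d)\<close>, so the fiber stays among the split pairs.\<close>
lemma split_pairs_fiber:
  assumes "x \<in> split_pairs"
  shows "{y \<in> F' \<times> F'. square_trace_det y = square_trace_det x} \<subseteq> split_pairs"
    and "card {y \<in> F' \<times> F'. square_trace_det y = square_trace_det x} = 4"
proof -
  obtain t d s where x: "x = (t, d)" and t: "t \<in> F'" and d: "d \<in> F'" and s: "s \<in> F'"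
    and r: "[s^2 = t^2 - 4 * d] (mod int p)"
    using assms by (auto simp: split_pairs_def)
  note neg = neg_in_F'[OF t] neg_in_F'[OF d] neg_in_F'[OF s]
  have roots: "[t'^2 = t^2 - 4 * d] (mod int p) \<longleftrightarrow> t' = s \<or> t' = int p - s" if "t' \<in> F'" for t'
    using square_cong_iff[OF s that] r by (metis cong_sym cong_trans)
  have eq: "{y \<in> F' \<times> F'. square_trace_det y = square_trace_det x} =
      {(t, d), (int p - t, d), (s, int p - d), (int p - s, int p - d)}" (is "?L = ?R")
  proof (rule Set.set_eqI)
    fix y :: "int \<times> int"
    obtain t' d' where y: "y = (t', d')" by force
    show "y \<in> ?L \<longleftrightarrow> y \<in> ?R"
    proof (cases "t' \<in> F' \<and> d' \<in> F'")
      case True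
      then show ?thesis
        using square_trace_det_eq_iff[OF t d, of t' d'] roots[of t'] unfolding x y by blast
    next
      case False
      then show ?thesis using t d s neg unfolding y by blast
    qed
  qed
  have "t \<noteq> int p - t" "d \<noteq> int p - d" "s \<noteq> int p - s"
    using neg_neq by metis+
  then show "card {y \<in> F' \<times> F'. square_trace_det y = square_trace_det x} = 4"
    unfolding eq by auto
  have neg_sq: "[(int p - u)^2 = u^2] (mod int p)" if "u \<in> F'" for u
    using square_cong_iff[OF that neg_in_F'[OF that]] by blast
  have 1: "[s^2 = (int p - t)^2 - 4 * d] (mod int p)"
    by (rule cong_lincomb[OF r neg_sq[OF t], of _ _ 1 "-1"]) simp
  have 2: "[t^2 = s^2 - 4 * (int p - d)] (mod int p)"
  proof -
    have "int p dvd (s^2 - (t^2 - 4 * d)) + int p * (-4)"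
      using r by (intro dvd_add) (simp_all add: cong_iff_dvd_diff)
    also have "(s^2 - (t^2 - 4 * d)) + int p * (-4) = s^2 - 4 * (int p - d) - t^2"
      by (simp add: algebra_simps)
    finally show ?thesis by (simp add: cong_iff_dvd_diff dvd_diff_commute)
  qed
  have 3: "[t^2 = (int p - s)^2 - 4 * (int p - d)] (mod int p)"
    by (rule cong_lincomb[OF 2 neg_sq[OF s], of _ _ 1 "-1"]) simp
  show "{y \<in> F' \<times> F'. square_trace_det y = square_trace_det x} \<subseteq> split_pairs"
    unfolding eq split_pairs_def using t d s neg r 1 2 3 by blast
qed

text \<open>Changing the sign of \<open>d\<close> would require a nonzero square root of the discriminant as the new
  trace, so only the sign of \<open>t\<close> is free.\<close>
lemma nonsplit_pairs_fiber:
  assumes "x \<in> F' \<times> F' - split_pairs"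
  shows "card {y \<in> F' \<times> F' - split_pairs. square_trace_det y = square_trace_det x} = 2"
proof -
  obtain t d where x: "x = (t, d)" and t: "t \<in> F'" and d: "d \<in> F'"
    and n: "\<And>s. s \<in> F' \<Longrightarrow> \<not> [s^2 = t^2 - 4 * d] (mod int p)"
    using assms unfolding split_pairs_def by blast
  have "{y \<in> F' \<times> F'. square_trace_det y = square_trace_det x} = {(t, d), (int p - t, d)}" (is "?L = ?R")
  proof (rule Set.set_eqI)
    fix y :: "int \<times> int"
    obtain t' d' where y: "y = (t', d')" by force
    show "y \<in> ?L \<longleftrightarrow> y \<in> ?R"
      using square_trace_det_eq_iff[OF t d, of t' d'] n[of t'] t d neg_in_F'[OF t] unfolding x y by blast
  qed
  moreover have "y \<notin> split_pairs" if "y \<in> F' \<times> F'" "square_trace_det y = square_trace_det x" for y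
    using split_pairs_fiber(1)[of y] that assms by auto
  ultimately have "{y \<in> F' \<times> F' - split_pairs. square_trace_det y = square_trace_det x} = {(t, d), (int p - t, d)}"
    by blast
  then show ?thesis using neg_neq[of t] by simp
qed

text \<open>A split pair is parametrized by \<open>t\<close> and a square root \<open>s\<close> of its discriminant, with \<open>s\<close>
  determined up to sign. The condition \<open>d \<noteq> 0\<close> excludes \<open>s = \<plusminus>t\<close>.\<close>
lemma card_split_pairs: "2 * card split_pairs = (p - 1) * (p - 3)"
proof -
  obtain j where "int p = 2 * j + 1"
    using odd_p by (metis even_of_nat oddE)
  \<comment> \<open>An inverse of 2, needed to solve \<open>s\<^sup>2 = t\<^sup>2 - 4 d\<close> for \<open>d\<close>.\<close>
  define h where "h = j + 1"
  have h: "[h * 2 = 1] (mod int p)"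
    using \<open>int p = 2 * j + 1\<close> by (simp add: h_def cong_iff_dvd_diff algebra_simps)
  define Y where "Y = (SIGMA t:F'. F' - {t, int p - t})"
  define k where "k = (\<lambda>(t, s). (t, h^2 * (t^2 - s^2) mod int p))"
  have h4: "[h^2 * 4 = 1] (mod int p)"
    using cong_mult[OF h h] by (simp add: power2_eq_square algebra_simps)
  have "card (F' - {t, int p - t}) = p - 3" if "t \<in> F'" for t
    using that neg_in_F'[OF that] neg_neq[of t] by (subst card_Diff_subset) auto
  then have "card Y = (p - 1) * (p - 3)"
    by (simp add: Y_def card_F' del: card_atLeastLessThan_int)
  moreover have "card Y = 2 * card (k ` Y)"
  proof (rule card_constant_fibers)
    fix x assume "x \<in> Y"
    then obtain t s where x: "x = (t, s)" and t: "t \<in> F'" and s: "s \<in> F'"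
      and ts: "s \<noteq> t" "s \<noteq> int p - t"
      unfolding Y_def by blast
    have "k (t, s') = k (t, s) \<longleftrightarrow> [s'^2 = s^2] (mod int p)" for s'
    proof
      assume "k (t, s') = k (t, s)"
      then have e: "[h^2 * (t^2 - s'^2) = h^2 * (t^2 - s^2)] (mod int p)"
        by (simp add: k_def cong_def)
      show "[s'^2 = s^2] (mod int p)"
        by (rule cong_lincomb[OF e h4, of _ _ "-4" "s^2 - s'^2"])
           (simp add: algebra_simps)
    next
      assume "[s'^2 = s^2] (mod int p)"
      then have "[h^2 * (t^2 - s'^2) = h^2 * (t^2 - s^2)] (mod int p)"
        by (intro cong_mult cong_diff) auto
      then show "k (t, s') = k (t, s)"
        by (simp add: k_def cong_def)
    qed
    moreover have "k (t', s') = k (t, s) \<longleftrightarrow> t' = t \<and> k (t, s') = k (t, s)" for t' s'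
      by (auto simp: k_def)
    ultimately have k_eq: "k (t', s') = k (t, s) \<longleftrightarrow> t' = t \<and> (s' = s \<or> s' = int p - s)"
      if "s' \<in> F'" for t' s'
      using square_cong_iff[OF s that] by metis
    have in_Y: "(t, s) \<in> Y" "(t, int p - s) \<in> Y"
      using t s ts by (auto simp: Y_def)
    have "{y \<in> Y. k y = k x} = {(t, s), (t, int p - s)}"
    proof (rule Set.set_eqI)
      fix y :: "int \<times> int"
      obtain t' s' where y: "y = (t', s')" by force
      have "s' \<in> F'" if "y \<in> Y" using that unfolding y Y_def by blast
      then show "y \<in> {y \<in> Y. k y = k x} \<longleftrightarrow> y \<in> {(t, s), (t, int p - s)}"
        using k_eq[of s' t'] in_Y s unfolding x y by blast
    qed
    then show "card {y \<in> Y. k y = k x} = 2"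
      using neg_neq[of s] by simp
  qed (simp add: Y_def)
  moreover have "k ` Y = split_pairs"
  proof (intro equalityI subsetI)
    fix z assume "z \<in> k ` Y"
    then obtain t s where z: "z = k (t, s)" and t: "t \<in> F'" and s: "s \<in> F'"
      and ts: "s \<noteq> t" "s \<noteq> int p - t"
      unfolding Y_def by blast
    define d where "d = h^2 * (t^2 - s^2) mod int p"
    have d: "[d = h^2 * (t^2 - s^2)] (mod int p)" by (simp add: d_def)
    have r: "[s^2 = t^2 - 4 * d] (mod int p)"
      by (rule cong_lincomb[OF d h4, of _ _ 4 "t^2 - s^2"]) (simp add: algebra_simps)
    have "\<not> int p dvd d"
    proof
      assume "int p dvd d"
      then have d0: "[d = 0] (mod int p)" by (simp add: cong_0_iff)
      have "[s^2 = t^2] (mod int p)"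
        by (rule cong_lincomb[OF r d0, of _ _ 1 "-4"]) (simp add: algebra_simps)
      then show False using square_cong_iff[OF t s] ts by blast
    qed
    then have "d \<in> F'" using mod_in_F'[of d] by (simp add: d_def)
    with r t s show "z \<in> split_pairs"
      by (auto simp: z k_def split_pairs_def d_def[symmetric] simp del: atLeastLessThan_iff)
  next
    fix z assume "z \<in> split_pairs"
    then obtain t d s where z: "z = (t, d)" and t: "t \<in> F'" and d: "d \<in> F'" and s: "s \<in> F'"
      and r: "[s^2 = t^2 - 4 * d] (mod int p)"
      by (auto simp: split_pairs_def)
    have e: "[h^2 * (t^2 - s^2) = d] (mod int p)"
      by (rule cong_lincomb[OF r h4, of _ _ "-(h^2)" d]) (simp add: algebra_simps)
    have "\<not> [s^2 = t^2] (mod int p)"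
    proof
      assume st: "[s^2 = t^2] (mod int p)"
      have "[d = 0] (mod int p)"
        by (rule cong_lincomb[OF e st, of _ _ "-1" "-(h^2)"]) (simp add: algebra_simps)
      then show False using F'_not_dvd[OF d] by (simp add: cong_0_iff)
    qed
    then have "(t, s) \<in> Y"
      using square_cong_iff[OF t s] t s unfolding Y_def by blast
    moreover have "k (t, s) = z"
      using e d by (simp add: k_def z cong_def)
    ultimately show "z \<in> k ` Y" by (metis imageI)
  qed
  ultimately show ?thesis by simp
qed

text \<open>With \<open>n = (p - 1) (p - 3) / 2\<close> split pairs among the \<open>(p - 1)\<^sup>2\<close> pairs, the image has
  \<open>n / 4 + ((p - 1)\<^sup>2 - n) / 2\<close> elements.\<close>
lemma card_square_trace_det: "8 * real (card (square_trace_det ` (F' \<times> F'))) = (real p - 1) * (3 * real p - 1)"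
proof -
  have sub: "split_pairs \<subseteq> F' \<times> F'" by (auto simp: split_pairs_def)
  then have fin: "finite split_pairs" by (rule finite_subset) simp
  have p3: "3 \<le> p" using p_gt_1 odd_p by presburger
  have "card split_pairs = 4 * card (square_trace_det ` split_pairs)"
  proof (rule card_constant_fibers[OF fin])
    fix x assume "x \<in> split_pairs"
    then have "{y \<in> split_pairs. square_trace_det y = square_trace_det x} = {y \<in> F' \<times> F'. square_trace_det y = square_trace_det x}"
      using split_pairs_fiber(1) sub by blast
    then show "card {y \<in> split_pairs. square_trace_det y = square_trace_det x} = 4"
      using split_pairs_fiber(2) \<open>x \<in> split_pairs\<close> by simp
  qed
  moreover have "card (F' \<times> F' - split_pairs) = 2 * card (square_trace_det ` (F' \<times> F' - split_pairs))"
    by (rule card_constant_fibers[OF _ nonsplit_pairs_fiber]) simp_all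
  moreover have "card (F' \<times> F' - split_pairs) + card split_pairs = (p - 1) * (p - 1)"
    using card_Diff_subset[OF fin sub] card_mono[OF _ sub]
    by (simp add: card_cartesian_product card_F' del: card_atLeastLessThan_int)
  moreover have "card (square_trace_det ` (F' \<times> F')) =
      card (square_trace_det ` split_pairs) + card (square_trace_det ` (F' \<times> F' - split_pairs))"
  proof -
    have "square_trace_det ` split_pairs \<inter> square_trace_det ` (F' \<times> F' - split_pairs) = {}"
    proof (rule ccontr)
      assume "\<not> ?thesis"
      then obtain z where "z \<in> square_trace_det ` split_pairs" "z \<in> square_trace_det ` (F' \<times> F' - split_pairs)"
        by blast
      then obtain x y where "x \<in> split_pairs" "y \<in> F' \<times> F' - split_pairs" "square_trace_det y = square_trace_det x"
        by (elim imageE) simp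
      then show False using split_pairs_fiber(1)[of x] by blast
    qed
    moreover have "square_trace_det ` (F' \<times> F') = square_trace_det ` split_pairs \<union> square_trace_det ` (F' \<times> F' - split_pairs)"
      using sub by blast
    ultimately show ?thesis using fin by (simp add: card_Un_disjoint)
  qed
  ultimately have "8 * card (square_trace_det ` (F' \<times> F')) + (p - 1) * (p - 3) = 4 * ((p - 1) * (p - 1))"
    using card_split_pairs by linarith
  then have "8 * real (card (square_trace_det ` (F' \<times> F'))) + real (p - 1) * real (p - 3) =
      4 * (real (p - 1) * real (p - 1))"
    by (metis of_nat_add of_nat_mult of_nat_numeral)
  then show ?thesis using p3 by (simp add: of_nat_diff algebra_simps)
qed

end

section \<open>Counting squares and nonsquares\<close>

context residues_prime
begin

definition squares :: "(int^2^2) set"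
  where "squares = {A \<in> GL2 p. \<exists>B \<in> GL2 p. A = reduce (B ** B)}"

lemma GL2_nonsquare_eq: "GL2_nonsquare p = GL2 p - squares"
  by (auto simp: GL2_nonsquare_def squares_def matrix_mult_eq simp flip: R_m_def)

lemma finite_GL2: "finite (GL2 p)"
  by (rule finite_subset[OF _ card_M(2)]) (auto simp: GL2_eq)

lemma finite_fiber: "finite (fiber T D)"
  by (rule finite_subset[OF _ card_M(2)]) (auto simp: fiber_def)

lemma fiber_disjoint:
  assumes "(T, D) \<in> F \<times> F" "(T', D') \<in> F \<times> F" "A \<in> fiber T D" "A \<in> fiber T' D'"
  shows "(T, D) = (T', D')"
proof -
  have "[T = T'] (mod int p)" "[D = D'] (mod int p)"
    using assms(3,4) unfolding fiber_def by (auto intro: cong_trans cong_sym)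
  then show ?thesis using assms(1,2) cong_in_F by blast
qed

lemma card_singular: "real (card (M - GL2 p)) \<le> real p ^ 3 + real p ^ 2"
proof -
  have "M - GL2 p \<subseteq> (\<Union>T\<in>F. fiber T 0)"
  proof
    fix A assume "A \<in> M - GL2 p"
    then have "A \<in> fiber (trace A mod int p) 0"
      by (simp add: GL2_eq fiber_def cong_0_iff)
    then show "A \<in> (\<Union>T\<in>F. fiber T 0)" using mod_in_F by blast
  qed
  then have "card (M - GL2 p) \<le> card (\<Union>T\<in>F. fiber T 0)"
    by (intro card_mono) (simp_all add: finite_fiber)
  also have "\<dots> \<le> (\<Sum>T\<in>F. card (fiber T 0))"
    by (rule card_UN_le) simp
  finally have "real (card (M - GL2 p)) \<le> (\<Sum>T\<in>F. real (card (fiber T 0)))"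
    by (metis of_nat_le_iff of_nat_sum)
  also have "\<dots> \<le> (\<Sum>T\<in>F. real p ^ 2 + real p)"
  proof (rule sum_mono)
    fix T show "real (card (fiber T 0)) \<le> real p ^ 2 + real p"
      using card_fiber_bounds[of T 0] by linarith
  qed
  also have "\<dots> = real p ^ 3 + real p ^ 2"
    by (simp add: eval_nat_numeral algebra_simps)
  finally show ?thesis .
qed

end

context residues_odd_prime
begin

text \<open>These are the squares of invertible matrices with nonzero trace. They form whole fibers of the
  trace and determinant; a fiber containing the square of a traceless matrix may also contain
  nonsquares.\<close>
definition traceful_squares :: "(int^2^2) set"
  where "traceful_squares = (\<Union>(T, D) \<in> square_trace_det ` (F' \<times> F'). fiber T D)"

lemma fiber_mod: "fiber (T mod int p) (D mod int p) = fiber T D"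
  by (simp add: fiber_def)

lemma traceful_squares_subset: "traceful_squares \<subseteq> squares"
proof
  fix A assume "A \<in> traceful_squares"
  then obtain t d where td: "t \<in> F'" "d \<in> F'" and A: "A \<in> fiber (t^2 - 2 * d) (d^2)"
    unfolding traceful_squares_def square_trace_det_def using fiber_mod by auto
  have "\<not> int p dvd d^2"
    using F'_not_dvd[OF td(2)] prime_int_p prime_dvd_power by blast
  with A have "A \<in> GL2 p"
    by (auto simp: GL2_eq fiber_def cong_dvd_iff)
  with fiber_squares[OF A] show "A \<in> squares"
    using F'_not_dvd td by (simp add: squares_def)
qed

lemma squares_subset: "squares \<subseteq> traceful_squares \<union> mat ` F"
proof
  fix A assume "A \<in> squares"
  then obtain B where B: "\<not> int p dvd det B" and A: "A = reduce (B ** B)"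
    by (auto simp: squares_def GL2_eq)
  define t d where "t = trace B mod int p" and "d = det B mod int p"
  show "A \<in> traceful_squares \<union> mat ` F"
  proof (cases "int p dvd trace B")
    case True
    then show ?thesis
      using traceless_square_scalar[of B] by (simp add: A cong_0_iff)
  next
    case False
    then have td: "(t, d) \<in> F' \<times> F'"
      using B mod_in_F' unfolding t_def d_def by blast
    have "A \<in> fiber (t^2 - 2 * d) (d^2)"
      unfolding A by (rule square_in_fiber) (simp_all add: t_def d_def)
    then have "A \<in> (case square_trace_det (t, d) of (T, D) \<Rightarrow> fiber T D)"
      by (simp add: square_trace_det_def fiber_mod)
    then have "A \<in> traceful_squares"
      unfolding traceful_squares_def by (intro UN_I[OF imageI[OF td]])
    then show ?thesis by blast
  qed
qed

lemma card_traceful_squares: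
  defines "m \<equiv> real (card (square_trace_det ` (F' \<times> F')))"
  shows "\<bar>real (card traceful_squares) - m * real p ^ 2\<bar> \<le> m * real p"
proof -
  let ?P = "square_trace_det ` (F' \<times> F')"
  have P: "?P \<subseteq> F \<times> F"
    by (auto simp: square_trace_det_def)
  have "card traceful_squares = (\<Sum>x\<in>?P. card (case x of (T, D) \<Rightarrow> fiber T D))"
    unfolding traceful_squares_def
  proof (rule card_UN_disjoint)
    show "\<forall>x\<in>?P. \<forall>y\<in>?P. x \<noteq> y \<longrightarrow>
        (case x of (T, D) \<Rightarrow> fiber T D) \<inter> (case y of (T, D) \<Rightarrow> fiber T D) = {}"
    proof (intro ballI impI, rule ccontr)
      fix x y assume "x \<in> ?P" "y \<in> ?P" "x \<noteq> y"
      moreover obtain T D T' D' where "x = (T, D)" "y = (T', D')" by force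
      moreover assume "(case x of (T, D) \<Rightarrow> fiber T D) \<inter> (case y of (T, D) \<Rightarrow> fiber T D) \<noteq> {}"
      ultimately show False
        using fiber_disjoint[of T D T' D'] subsetD[OF P, of x] subsetD[OF P, of y]
        by (metis (no_types, lifting) disjoint_iff case_prod_conv)
    qed
  qed (simp_all add: finite_fiber split: prod.split)
  then have "real (card traceful_squares) - m * real p ^ 2 =
      (\<Sum>x\<in>?P. real (card (case x of (T, D) \<Rightarrow> fiber T D)) - real p ^ 2)"
    by (simp add: m_def sum_subtractf)
  also have "\<bar>\<dots>\<bar> \<le> (\<Sum>x\<in>?P. real p)"
    by (rule order_trans[OF sum_abs sum_mono]) (auto split: prod.split intro: card_fiber_bounds)
  finally show ?thesis by (simp add: m_def)
qed

text \<open>The coefficient 5/8 is 1 - 3/8: by the exact count of trace-determinant pairs, about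
  \<open>3 p\<^sup>2 / 8\<close> fibers of about \<open>p\<^sup>2\<close> matrices each consist of squares.\<close>
lemma GL2_nonsquare_estimate:
  "\<bar>real (card (GL2_nonsquare p)) - 5 / 8 * real p ^ 4\<bar> \<le> 4 * real p ^ 3"
proof -
  define m Z S Q where "m = real (card (square_trace_det ` (F' \<times> F')))"
    and "Z = real (card ((M :: (int^2^2) set) - GL2 p))"
    and "S = real (card traceful_squares)" and "Q = real (card squares)"
  have GM: "GL2 p \<subseteq> M" by (auto simp: GL2_eq)
  have SG: "squares \<subseteq> GL2 p" by (auto simp: squares_def)
  have fin: "finite squares" using SG finite_GL2 finite_subset by blast
  have "card (GL2 p) + card (M - GL2 p) = p ^ 4"
    using card_Diff_subset[OF finite_GL2 GM] card_mono[OF card_M(2) GM] card_M(1) by simp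
  then have "real (card (GL2 p)) + Z = real p ^ 4"
    unfolding Z_def by (metis of_nat_add of_nat_power)
  moreover have "card (GL2_nonsquare p) + card squares = card (GL2 p)"
    unfolding GL2_nonsquare_eq
    using card_Diff_subset[OF fin SG] card_mono[OF finite_GL2 SG] by simp
  then have "real (card (GL2_nonsquare p)) + Q = real (card (GL2 p))"
    unfolding Q_def by (metis of_nat_add)
  ultimately have N: "real (card (GL2_nonsquare p)) = real p ^ 4 - Z - Q" by simp
  have SQ: "S \<le> Q"
    unfolding S_def Q_def using card_mono[OF fin traceful_squares_subset] by simp
  have "finite traceful_squares"
    using traceful_squares_subset fin finite_subset by blast
  then have "card squares \<le> card (traceful_squares \<union> mat ` F)"
    by (intro card_mono[OF _ squares_subset]) simp
  also have "\<dots> \<le> card traceful_squares + card (mat ` F :: (int^2^2) set)"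
    by (rule card_Un_le)
  also have "\<dots> \<le> card traceful_squares + p"
    using card_image_le[of F "mat :: int \<Rightarrow> int^2^2"] by simp
  finally have QS: "Q \<le> S + real p" unfolding Q_def S_def by linarith
  have Z: "0 \<le> Z" "Z \<le> real p ^ 3 + real p ^ 2"
    using card_singular by (simp_all add: Z_def)
  have S: "\<bar>S - m * real p ^ 2\<bar> \<le> m * real p"
    using card_traceful_squares by (simp add: S_def m_def)
  have m: "m = 3 / 8 * real p ^ 2 - real p / 2 + 1 / 8"
    using card_square_trace_det by (simp add: m_def power2_eq_square algebra_simps)
  have mp: "m * real p = 3 / 8 * real p ^ 3 - real p ^ 2 / 2 + real p / 8"
    "m * real p ^ 2 = 3 / 8 * real p ^ 4 - real p ^ 3 / 2 + real p ^ 2 / 8"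
    unfolding m by (simp_all add: eval_nat_numeral algebra_simps)
  \<comment> \<open>The terms of degree 4 cancel, and these two facts bound the others by multiples of \<open>p\<^sup>3\<close>.\<close>
  have "real p \<le> real p ^ 3" "real p ^ 2 \<le> real p ^ 3"
    using p_gt_1 self_le_power[of "real p" 3] power_increasing[of 2 3 "real p"] by simp_all
  then show ?thesis
    using N SQ QS Z S unfolding mp abs_le_iff by linarith
qed

end

text \<open>The case \<open>p = 2\<close>, where neither signs nor the discriminant are of use, needs only this bound.\<close>
lemma GL2_nonsquare_le: "prime p \<Longrightarrow> card (GL2_nonsquare p) \<le> p ^ 4"
proof -
  assume "prime p"
  then interpret residues_prime p "residue_ring (int p)"
    by unfold_locales
  have "GL2_nonsquare p \<subseteq> M"
    unfolding GL2_nonsquare_eq GL2_eq by blast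
  then show ?thesis
    using card_mono[OF card_M(2)] card_M(1) by metis
qed

theorem mainTheorem7:
  shows "\<exists>K::real. \<forall>p::nat. prime p \<longrightarrow>
    \<bar>real (card (GL2_nonsquare p)) - 5 / 8 * real p ^ 4\<bar> \<le> K * real p ^ 3"
proof (intro exI[of _ 4] allI impI)
  fix p :: nat assume p: "prime p"
  show "\<bar>real (card (GL2_nonsquare p)) - 5 / 8 * real p ^ 4\<bar> \<le> 4 * real p ^ 3"
  proof (cases "odd p")
    case True
    with p interpret residues_odd_prime p "residue_ring (int p)"
      by unfold_locales
    show ?thesis by (rule GL2_nonsquare_estimate)
  next
    case False
    then have "p = 2" using p primes_dvd_imp_eq two_is_prime_nat by blast
    then show ?thesis using GL2_nonsquare_le[OF p] by simp
  qed
qed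

end
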